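(* Let $m\ge 2$ be an integer and let $\mathbf{k}=(k_0,k_1,k_2,\ldots)$ be a sequence of positive integers. Let $$C^{(\mathbf{k})}_m(q)=1+\sum_{n=1}^{\infty}c^{(\mathbf{k})}_m(n)\,q^n=1+\sum_{i=0}^{\infty}\prod_{j=0}^{i}\left(\left(1-q^{m^j}\right)^{-k_j}-1\right)$$ be the generating function for the numbers $c^{(\mathbf{k})}_m(n)$ of $\mathbf{k}$-coloured $m$-ary partitions of $n$ without gaps. If $m$ is relatively prime to $(k_0-1)!$ and to $k_j!$ for all $j\ge 1$, then $$C^{(\mathbf{k})}_m(q)\equiv 1+\left(\sum_{\ell_0=1}^{m}\binom{k_0-1+\ell_0}{k_0-1}q^{\ell_0}\right)\sum_{i=0}^{\infty}\left(1-q^{m^{i+1}}\right)^{-1}\prod_{j=1}^{i}\left(\sum_{\ell_j=0}^{m-1}\left\{\binom{k_j+\ell_j}{k_j}-1\right\}q^{\ell_jm^j}\right)\pmod m.$$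
   Context: An $m$-ary partition of an integer $n$ is an integer partition of $n$ in which each part is a nonnegative integer power of the fixed integer $m\ge 2$. Given a sequence $\mathbf{k}=(k_0,k_1,\ldots)$ of positive integers, an $m$-ary partition is $\mathbf{k}$-coloured when there are $k_j$ colours for the part $m^j$, for each $j\ge 0$; that is, there are $k_j$ different kinds of parts of the same size $m^j$ (so a $\mathbf{k}$-coloured $m$-ary partition of $n$ is a finite multiset of pairs $(j,c)$ with $j\ge 0$, $1\le c\le k_j$, whose sizes $m^j$ sum to $n$). It is without gaps if, for every nonnegative integer $j$, some part $m^j$ of any colour occurs whenever some part $m^{j+1}$ of any colour (not necessarily the same colour) occurs. For $n\ge 1$, $c^{(\mathbf{k})}_m(n)$ denotes the number of $\mathbf{k}$-coloured $m$-ary partitions of $n$ without gaps. Series are formal power series in $q$ with integer coefficients, and $\equiv \pmod m$ between two such series means that coefficients of equal powers of $q$ are congruent modulo $m$. Empty products equal $1$. *)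

theory Defs
  imports
    "HOL-Library.Multiset"
    "HOL-Computational_Algebra.Formal_Power_Series"
    "HOL-Number_Theory.Cong"
begin

text \<open>A part is a pair \<open>(j, c)\<close>: the part \<open>m ^ j\<close> in colour \<open>c\<close>, where \<open>1 \<le> c \<le> k j\<close>.\<close>

definition coloured_mary_partitions :: "nat \<Rightarrow> (nat \<Rightarrow> nat) \<Rightarrow> nat \<Rightarrow> (nat \<times> nat) multiset set" where
  "coloured_mary_partitions m k n =
     {P. (\<forall>(j, c) \<in> set_mset P. 1 \<le> c \<and> c \<le> k j) \<and> (\<Sum>(j, c) \<in># P. m ^ j) = n}"

definition without_gaps :: "(nat \<times> nat) multiset \<Rightarrow> bool" where
  "without_gaps P \<longleftrightarrow> (\<forall>j. (\<exists>c. (Suc j, c) \<in># P) \<longrightarrow> (\<exists>c. (j, c) \<in># P))"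

definition num_gapless :: "nat \<Rightarrow> (nat \<Rightarrow> nat) \<Rightarrow> nat \<Rightarrow> nat" where
  "num_gapless m k n = card {P \<in> coloured_mary_partitions m k n. without_gaps P}"

definition gapless_gf :: "nat \<Rightarrow> (nat \<Rightarrow> nat) \<Rightarrow> int fps" where
  "gapless_gf m k = Abs_fps (\<lambda>n. if n = 0 then 1 else int (num_gapless m k n))"

text \<open>The series \<open>(1 - q ^ N)\<^sup>-\<^sup>1\<close>. Since \<^typ>\<open>int\<close> has no \<^const>\<open>inverse\<close>, neither does
  \<^typ>\<open>int fps\<close>; the library's \<open>fps_left_inverse f x\<close> is the inverse of \<open>f\<close> with constant
  coefficient \<open>x\<close>.\<close>

definition inv_one_minus_X_power :: "nat \<Rightarrow> int fps" where
  "inv_one_minus_X_power N = fps_left_inverse (1 - fps_X ^ N) 1"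

definition fps_cong :: "int fps \<Rightarrow> int fps \<Rightarrow> int \<Rightarrow> bool" where
  "fps_cong f g m \<longleftrightarrow> (\<forall>n. [fps_nth f n = fps_nth g n] (mod m))"

lemma inv_one_minus_X_power:
  assumes "N \<ge> 1"
  shows "inv_one_minus_X_power N * (1 - fps_X ^ N) = 1"
  unfolding inv_one_minus_X_power_def
  by (rule fps_left_inverse) (use assms in \<open>simp add: fps_X_power_nth\<close>)

lemma finite_coloured_mary_partitions:
  assumes "m \<ge> 2"
  shows "finite (coloured_mary_partitions m k n)"
proof -
  define A where "A = (SIGMA j:{..n}. {..k j})"
  have sub: "P \<in> mset ` {xs. set xs \<subseteq> A \<and> length xs \<le> n}"
    if P: "P \<in> coloured_mary_partitions m k n" for P
  proof -
    obtain xs where xs: "P = mset xs"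
      by (metis ex_mset)
    have sum: "(\<Sum>(j, c) \<in># P. m ^ j) = n"
      using P by (simp add: coloured_mary_partitions_def)
    have "size P = (\<Sum>x \<in># P. 1)"
      by (rule size_eq_sum_mset)
    also have "\<dots> \<le> (\<Sum>(j, c) \<in># P. m ^ j)"
      by (rule sum_mset_mono) (use assms in \<open>simp split: prod.split\<close>)
    finally have "length xs \<le> n"
      using sum xs by simp
    moreover have "x \<in> A" if "x \<in># P" for x
    proof -
      obtain j c where x: "x = (j, c)" by force
      from that have "P = add_mset x (P - {#x#})"
        by simp
      hence "(\<Sum>(j, c) \<in># P. m ^ j) = m ^ j + (\<Sum>(j, c) \<in># P - {#x#}. m ^ j)"
        using x by (metis (no_types, lifting) case_prod_conv sum_mset.insert)
      hence "m ^ j \<le> n"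
        using sum by linarith
      moreover have "j < m ^ j"
        using assms by (intro power_gt_expt) simp
      ultimately have "j \<le> n" by linarith
      thus ?thesis
        using P that x by (auto simp: A_def coloured_mary_partitions_def)
    qed
    ultimately show ?thesis
      using xs by auto
  qed
  have "finite {xs. set xs \<subseteq> A \<and> length xs \<le> n}"
    by (intro finite_lists_length_le) (auto simp: A_def)
  thus ?thesis
    by (rule finite_surj) (use sub in blast)
qed

text \<open>Infinite sums of power series are limits in the \<open>X\<close>-adic topology on \<^typ>\<open>int fps\<close>. The
  two families summed in the theorem are summable, so \<^const>\<open>suminf\<close> denotes the actual sum.\<close>

lemma fps_summableI:
  fixes f :: "nat \<Rightarrow> int fps"
  assumes "\<And>i. fps_X ^ i dvd f i"
  shows "summable f"
proof -
  have zero: "fps_nth (f i) n = 0" if "n < i" for i n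
    using that assms[of i] by (elim dvdE) (simp add: fps_X_power_mult_nth)
  have "f sums Abs_fps (\<lambda>n. \<Sum>i<Suc n. fps_nth (f i) n)"
    unfolding sums_def
  proof (rule tendsto_fpsI)
    fix n
    have "(\<Sum>i<N. fps_nth (f i) n) = (\<Sum>i<Suc n. fps_nth (f i) n)" if "N \<ge> Suc n" for N
      by (rule sum.mono_neutral_right) (use that in \<open>auto intro: zero\<close>)
    hence "\<forall>\<^sub>F N in sequentially. (\<Sum>i<N. fps_nth (f i) n) = (\<Sum>i<Suc n. fps_nth (f i) n)"
      by (rule eventually_sequentiallyI)
    thus "\<forall>\<^sub>F N in sequentially. fps_nth (\<Sum>i<N. f i) n =
        fps_nth (Abs_fps (\<lambda>n. \<Sum>i<Suc n. fps_nth (f i) n)) n"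
      by (simp only: fps_sum_nth fps_nth_Abs_fps)
  qed
  thus ?thesis by (rule sums_summable)
qed

lemma fps_X_dvd:
  assumes "fps_nth (f :: int fps) 0 = 0"
  shows "fps_X dvd f"
proof
  show "f = fps_X * fps_shift 1 f"
    by (rule fps_ext) (use assms in \<open>simp add: fps_X_mult_nth\<close>)
qed

lemma summable_gapless_series:
  "summable (\<lambda>i. \<Prod>j=0..i. (inv_one_minus_X_power (m ^ j) ^ k j - 1))"
proof (rule fps_summableI)
  fix i
  have "fps_X dvd inv_one_minus_X_power (m ^ j) ^ k j - 1" for j
    by (rule fps_X_dvd) (simp add: inv_one_minus_X_power_def fps_power_zeroth)
  hence "(\<Prod>j=0..i. fps_X) dvd (\<Prod>j=0..i. (inv_one_minus_X_power (m ^ j) ^ k j - 1))"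
    by (intro prod_dvd_prod) auto
  moreover have "(fps_X :: int fps) ^ i dvd (\<Prod>j=0..i. fps_X)"
    by simp
  ultimately show "fps_X ^ i dvd (\<Prod>j=0..i. (inv_one_minus_X_power (m ^ j) ^ k j - 1))"
    by (metis dvd_trans)
qed

lemma summable_congruence_series:
  assumes "m \<ge> 2"
  shows "summable (\<lambda>i. inv_one_minus_X_power (m ^ (i + 1)) *
           (\<Prod>j=1..i. \<Sum>l=0..m - 1. fps_const (int ((k j + l) choose k j) - 1) * fps_X ^ (l * m ^ j)))"
proof (rule fps_summableI)
  fix i
  have "fps_X dvd (\<Sum>l=0..m - 1. fps_const (int ((k j + l) choose k j) - 1) * fps_X ^ (l * m ^ j))" for j
    using assms by (intro fps_X_dvd) (auto simp: fps_sum_nth intro!: sum.neutral)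
  hence "(\<Prod>j=1..i. fps_X) dvd
      (\<Prod>j=1..i. \<Sum>l=0..m - 1. fps_const (int ((k j + l) choose k j) - 1) * fps_X ^ (l * m ^ j))"
    by (intro prod_dvd_prod) auto
  thus "fps_X ^ i dvd inv_one_minus_X_power (m ^ (i + 1)) *
      (\<Prod>j=1..i. \<Sum>l=0..m - 1. fps_const (int ((k j + l) choose k j) - 1) * fps_X ^ (l * m ^ j))"
    by (intro dvd_mult) simp
qed

end

theory Submission
  imports Defs
begin

unbundle fps_syntax

text \<open>Grouping the parts of a gapless partition by size factors the generating function of those
  with largest part \<open>m ^ i\<close> as \<open>F 0 * \<dots> * F i\<close>, where \<open>F j = (1 - q ^ m ^ j) ^ (- k j) - 1\<close>.
  The congruence already holds term by term. If \<open>k!\<close> is a unit modulo \<open>m\<close>, then \<open>(k + n) choose k\<close>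
  is \<open>m\<close>-periodic in \<open>n\<close> modulo \<open>m\<close>. Hence \<open>F 0\<close> is congruent to a polynomial times
  \<open>(1 - q ^ m) ^ (- 1)\<close>, and \<open>F j * (1 - q ^ m ^ j) ^ (- 1)\<close> is congruent to a polynomial times
  \<open>(1 - q ^ m ^ (j + 1)) ^ (- 1)\<close>, so that the geometric factor moves through the product.\<close>

section \<open>Generating functions of multisets\<close>

text \<open>Every element weighs at least 1, so the size is at most \<open>n\<close>, and finitely
  many lists represent all these multisets.\<close>

lemma finite_msets_of_weight:
  assumes "finite A" "\<And>a. a \<in> A \<Longrightarrow> w a \<ge> (1::nat)"
  shows "finite {P. set_mset P \<subseteq> A \<and> (\<Sum>x\<in>#P. w x) = n}"
proof -
  have "P \<in> mset ` {xs. set xs \<subseteq> A \<and> length xs \<le> n}"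
    if P: "set_mset P \<subseteq> A" "(\<Sum>x\<in>#P. w x) = n" for P
  proof -
    obtain xs where xs: "P = mset xs" by (metis ex_mset)
    have "size P = (\<Sum>x\<in>#P. 1)" by (rule size_eq_sum_mset)
    also have "\<dots> \<le> (\<Sum>x\<in>#P. w x)"
      by (rule sum_mset_mono) (use assms P in auto)
    finally show ?thesis using P xs by auto
  qed
  hence "{P. set_mset P \<subseteq> A \<and> (\<Sum>x\<in>#P. w x) = n} \<subseteq> mset ` {xs. set xs \<subseteq> A \<and> length xs \<le> n}"
    by blast
  thus ?thesis
    by (rule finite_surj[OF finite_lists_length_le[OF assms(1)]])
qed

text \<open>As \<open>card\<close> of an infinite set is 0, this counts correctly only when each
  weight is attained by finitely many members of \<open>S\<close>.\<close>

definition mset_gf :: "('a \<Rightarrow> nat) \<Rightarrow> 'a multiset set \<Rightarrow> int fps" where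
  "mset_gf w S = Abs_fps (\<lambda>n. int (card {P \<in> S. (\<Sum>x\<in>#P. w x) = n}))"

text \<open>Disjoint supports make the decomposition \<open>P + Q\<close> unique and weights add, so
  the counts form a Cauchy product.\<close>

lemma mset_gf_plus:
  assumes "finite A" "finite B" "A \<inter> B = {}" and w: "\<And>a. a \<in> A \<union> B \<Longrightarrow> w a \<ge> 1"
    and S: "\<And>P. P \<in> S \<Longrightarrow> set_mset P \<subseteq> A" and T: "\<And>P. P \<in> T \<Longrightarrow> set_mset P \<subseteq> B"
  shows "mset_gf w {P + Q | P Q. P \<in> S \<and> Q \<in> T} = mset_gf w S * mset_gf w T"
proof (rule fps_ext)
  fix n
  define L where "L U i = {P \<in> U. (\<Sum>x\<in>#P. w x) = i}" for U i
  let ?f = "\<lambda>(P, Q). P + Q"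
  have fin: "finite (L S i)" "finite (L T i)" for i
  proof -
    have "L S i \<subseteq> {P. set_mset P \<subseteq> A \<and> (\<Sum>x\<in>#P. w x) = i}"
      "L T i \<subseteq> {P. set_mset P \<subseteq> B \<and> (\<Sum>x\<in>#P. w x) = i}"
      using S T by (auto simp: L_def)
    thus "finite (L S i)" "finite (L T i)"
      using finite_msets_of_weight[of A w i] finite_msets_of_weight[of B w i] assms(1,2) w
      by (metis (no_types, lifting) UnCI finite_subset)+
  qed
  have inj: "inj_on ?f (S \<times> T)"
  \<comment> \<open>Both summands are recovered from the sum by restricting it to \<open>A\<close>
    and to \<open>B\<close>.\<close>
  proof (rule inj_on_inverseI[where g = "\<lambda>R. (filter_mset (\<lambda>x. x \<in> A) R, filter_mset (\<lambda>x. x \<in> B) R)"])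
    fix x assume x: "x \<in> S \<times> T"
    obtain P Q where [simp]: "x = (P, Q)" by force
    have "set_mset P \<subseteq> A" "set_mset Q \<subseteq> B" using x S T by auto
    hence "filter_mset (\<lambda>x. x \<in> A) P = P" "filter_mset (\<lambda>x. x \<in> A) Q = {#}"
      "filter_mset (\<lambda>x. x \<in> B) Q = Q" "filter_mset (\<lambda>x. x \<in> B) P = {#}"
      using assms(3) by (auto simp: filter_mset_eq_conv)
    thus "(filter_mset (\<lambda>x. x \<in> A) (?f x), filter_mset (\<lambda>x. x \<in> B) (?f x)) = x"
      by simp
  qed
  \<comment> \<open>The pairs are sorted by the weight \<open>i\<close> of the first summand, which
    makes the union disjoint.\<close>
  have "L {P + Q | P Q. P \<in> S \<and> Q \<in> T} n = ?f ` (\<Union>i\<in>{0..n}. L S i \<times> L T (n - i))"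
    by (force simp: L_def)
  also have "card \<dots> = card (\<Union>i\<in>{0..n}. L S i \<times> L T (n - i))"
    by (rule card_image, rule inj_on_subset[OF inj]) (auto simp: L_def)
  also have "\<dots> = (\<Sum>i=0..n. card (L S i) * card (L T (n - i)))"
    by (subst card_UN_disjoint) (auto simp: fin card_cartesian_product, auto simp: L_def)
  finally show "mset_gf w {P + Q | P Q. P \<in> S \<and> Q \<in> T} $ n = (mset_gf w S * mset_gf w T) $ n"
    by (simp add: mset_gf_def fps_mult_nth L_def)
qed

section \<open>Power series in \<open>q ^ N\<close> and geometric series\<close>

text \<open>For \<open>N \<ge> 1\<close> this is A(q^N), where A is the ordinary generating function
  of \<open>a\<close>.\<close>

definition dilated_fps :: "nat \<Rightarrow> (nat \<Rightarrow> int) \<Rightarrow> int fps" where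
  "dilated_fps N a = Abs_fps (\<lambda>n. if N dvd n then a (n div N) else 0)"

text \<open>The factor acts on the coefficient sequence as the difference operator with step
  \<open>r\<close>. Step 1 serves inverse powers, step \<open>m\<close> serves sequences that are
  periodic modulo \<open>m\<close>.\<close>

lemma dilated_fps_mult_one_minus:
  assumes "N \<ge> 1"
  shows "dilated_fps N a * (1 - fps_X ^ (r * N)) =
    dilated_fps N (\<lambda>t. a t - (if r \<le> t then a (t - r) else 0))"
proof (rule fps_ext)
  fix n
  show "(dilated_fps N a * (1 - fps_X ^ (r * N))) $ n =
    dilated_fps N (\<lambda>t. a t - (if r \<le> t then a (t - r) else 0)) $ n"
  proof (cases "N dvd n")
    case True
    then obtain t where t: "n = N * t" by blast
    have "N * t - r * N = N * (t - r)"
      by (simp add: diff_mult_distrib2 mult.commute)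
    moreover have "N * t < r * N \<longleftrightarrow> t < r"
      using assms by (simp add: mult.commute[of r])
    ultimately show ?thesis
      using t assms by (auto simp: dilated_fps_def right_diff_distrib fps_X_power_mult_right_nth)
  next
    case False
    moreover have "\<not> N dvd n - r * N" if "\<not> n < r * N"
      using that False by (metis dvd_diffD dvd_triv_right not_less)
    ultimately show ?thesis
      by (auto simp: dilated_fps_def right_diff_distrib fps_X_power_mult_right_nth)
  qed
qed

lemma inv_one_minus_X_power_eqI:
  assumes "N \<ge> 1" "f * (1 - fps_X ^ N) = g"
  shows "f = g * inv_one_minus_X_power N"
  using inv_one_minus_X_power[OF assms(1)] assms(2) by (metis mult.assoc mult.commute mult.right_neutral)

lemma inv_one_minus_X_power_conv_dilated_fps:
  assumes "N \<ge> 1"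
  shows "inv_one_minus_X_power N = dilated_fps N (\<lambda>_. 1)"
proof -
  have "dilated_fps N (\<lambda>_. 1) * (1 - fps_X ^ N) = 1"
    using dilated_fps_mult_one_minus[OF assms, of "\<lambda>_. 1" 1] assms
    by (auto simp: fps_eq_iff dilated_fps_def)
  from inv_one_minus_X_power_eqI[OF assms this] show ?thesis by simp
qed

text \<open>A multiset over one element is determined by its multiplicity, so each multiple of
  \<open>w a\<close> is attained exactly once.\<close>

lemma mset_gf_singleton:
  assumes "w a \<ge> 1"
  shows "mset_gf w {P. set_mset P \<subseteq> {a}} = inv_one_minus_X_power (w a)"
proof -
  have "{P \<in> {P. set_mset P \<subseteq> {a}}. (\<Sum>x\<in>#P. w x) = n} =
      (if w a dvd n then {replicate_mset (n div w a) a} else {})" for n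
  proof -
    have "P \<in> {P. set_mset P \<subseteq> {a}} \<and> (\<Sum>x\<in>#P. w x) = n \<longleftrightarrow>
        w a dvd n \<and> P = replicate_mset (n div w a) a" for P
    proof
      assume P: "P \<in> {P. set_mset P \<subseteq> {a}} \<and> (\<Sum>x\<in>#P. w x) = n"
      then obtain r where "P = replicate_mset r a"
        using set_mset_subset_singletonD[of P a] by blast
      thus "w a dvd n \<and> P = replicate_mset (n div w a) a"
        using P assms by auto
    qed auto
    thus ?thesis by auto
  qed
  thus ?thesis
    using assms
    by (auto simp: mset_gf_def inv_one_minus_X_power_conv_dilated_fps dilated_fps_def fps_eq_iff)
qed

text \<open>Induction on \<open>A\<close>: splitting off all copies of one element contributes one
  geometric factor.\<close>

lemma mset_gf_supported:
  assumes "finite A" "\<And>a. a \<in> A \<Longrightarrow> w a \<ge> 1"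
  shows "mset_gf w {P. set_mset P \<subseteq> A} = (\<Prod>a\<in>A. inv_one_minus_X_power (w a))"
  using assms
proof (induction A rule: finite_induct)
  case empty
  have "{P \<in> {P. set_mset P \<subseteq> {}}. (\<Sum>x\<in>#P. w x) = n} = (if n = 0 then {{#}} else {})" for n
    by auto
  thus ?case by (auto simp: mset_gf_def fps_eq_iff)
next
  case (insert a A)
  have "P \<in> {P + Q | P Q. P \<in> {P. set_mset P \<subseteq> {a}} \<and> Q \<in> {P. set_mset P \<subseteq> A}}"
    if "set_mset P \<subseteq> insert a A" for P
  proof -
    have "P = filter_mset (\<lambda>x. x = a) P + filter_mset (\<lambda>x. x \<noteq> a) P"
      by (rule multiset_partition)
    moreover have "set_mset (filter_mset (\<lambda>x. x = a) P) \<subseteq> {a}"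
      "set_mset (filter_mset (\<lambda>x. x \<noteq> a) P) \<subseteq> A"
      using that by auto
    ultimately show ?thesis by blast
  qed
  hence "{P. set_mset P \<subseteq> insert a A} =
      {P + Q | P Q. P \<in> {P. set_mset P \<subseteq> {a}} \<and> Q \<in> {P. set_mset P \<subseteq> A}}"
    by (intro equalityI subsetI) (blast, auto)
  moreover have "mset_gf w \<dots> = mset_gf w {P. set_mset P \<subseteq> {a}} * mset_gf w {P. set_mset P \<subseteq> A}"
    by (rule mset_gf_plus[where A = "{a}" and B = A]) (use insert in auto)
  ultimately show ?case
    using insert by (simp add: mset_gf_singleton)
qed

text \<open>The empty multiset has weight 0, so excluding it lowers only the constant coefficient,
  by 1.\<close>

lemma mset_gf_supported_nonempty:
  assumes "finite A" "\<And>a. a \<in> A \<Longrightarrow> w a \<ge> 1"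
  shows "mset_gf w {P. set_mset P \<subseteq> A \<and> P \<noteq> {#}} = (\<Prod>a\<in>A. inv_one_minus_X_power (w a)) - 1"
proof -
  have "int (card {P \<in> {P. set_mset P \<subseteq> A \<and> P \<noteq> {#}}. (\<Sum>x\<in>#P. w x) = n}) =
     int (card {P \<in> {P. set_mset P \<subseteq> A}. (\<Sum>x\<in>#P. w x) = n}) - (if n = 0 then 1 else 0)" for n
  proof (cases "n = 0")
    case True
    let ?Z = "{P \<in> {P. set_mset P \<subseteq> A}. (\<Sum>x\<in>#P. w x) = 0}"
    have "{P \<in> {P. set_mset P \<subseteq> A \<and> P \<noteq> {#}}. (\<Sum>x\<in>#P. w x) = 0} = ?Z - {{#}}"
      by auto
    moreover have "Suc (card (?Z - {{#}})) = card ?Z"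
    proof (rule card_Suc_Diff1)
      show "finite ?Z" using finite_msets_of_weight[of A w 0] assms by auto
    qed simp
    ultimately show ?thesis using True by simp
  next
    case False
    hence "{P \<in> {P. set_mset P \<subseteq> A \<and> P \<noteq> {#}}. (\<Sum>x\<in>#P. w x) = n} =
      {P \<in> {P. set_mset P \<subseteq> A}. (\<Sum>x\<in>#P. w x) = n}" by auto
    with False show ?thesis by simp
  qed
  thus ?thesis
    using mset_gf_supported[of A w] assms by (simp add: mset_gf_def fps_eq_iff)
qed

section \<open>Partitions without gaps\<close>

text \<open>These are the coloured gapless partitions with largest part \<open>m ^ i\<close>,
  described by their set of exponents; \<open>m\<close> enters only through the weight
  function.\<close>

definition gapless_upto :: "(nat \<Rightarrow> nat) \<Rightarrow> nat \<Rightarrow> (nat \<times> nat) multiset set" where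
  "gapless_upto k i = {P. set_mset P \<subseteq> (SIGMA j:{0..i}. {1..k j}) \<and> fst ` set_mset P = {0..i}}"

lemma gapless_upto_0: "gapless_upto k 0 = {P. set_mset P \<subseteq> {0} \<times> {1..k 0} \<and> P \<noteq> {#}}"
proof -
  have "fst ` set_mset P = {0} \<longleftrightarrow> P \<noteq> {#}" if "set_mset P \<subseteq> {0} \<times> {1..k 0}" for P
  proof -
    have "fst ` set_mset P \<subseteq> {0}" using that by auto
    thus ?thesis by (metis image_is_empty set_mset_eq_empty_iff subset_singletonD insert_not_empty)
  qed
  moreover have "(SIGMA j:{0..0}. {1..k j}) = {0} \<times> {1..k 0}" by auto
  ultimately show ?thesis unfolding gapless_upto_def by auto
qed

text \<open>Cutting at exponent \<open>i\<close> leaves a gapless partition below and an arbitrary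
  nonempty multiset of coloured copies of the largest part above.\<close>

lemma gapless_upto_Suc:
  "gapless_upto k (Suc i) =
    {P + Q | P Q. P \<in> gapless_upto k i \<and> Q \<in> {P. set_mset P \<subseteq> {Suc i} \<times> {1..k (Suc i)} \<and> P \<noteq> {#}}}"
  (is "_ = ?R")
proof (intro equalityI subsetI)
  fix R assume R: "R \<in> gapless_upto k (Suc i)"
  define P where "P = filter_mset (\<lambda>x. fst x \<le> i) R"
  define Q where "Q = filter_mset (\<lambda>x. \<not> fst x \<le> i) R"
  have "R = P + Q" unfolding P_def Q_def by (rule multiset_partition)
  have sub: "set_mset R \<subseteq> (SIGMA j:{0..Suc i}. {1..k j})" and img: "fst ` set_mset R = {0..Suc i}"
    using R by (auto simp: gapless_upto_def)
  have "fst ` set_mset P = {0..i}"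
  proof
    show "{0..i} \<subseteq> fst ` set_mset P"
    proof
      fix j assume j: "j \<in> {0..i}"
      hence "j \<in> fst ` set_mset R" unfolding img by simp
      with j show "j \<in> fst ` set_mset P" by (auto simp: P_def image_iff)
    qed
  qed (auto simp: P_def)
  moreover have "set_mset P \<subseteq> (SIGMA j:{0..i}. {1..k j})" "set_mset Q \<subseteq> {Suc i} \<times> {1..k (Suc i)}"
    using sub by (auto simp: P_def Q_def le_Suc_eq)
  moreover have "Suc i \<in> fst ` set_mset R" unfolding img by simp
  then obtain c where "(Suc i, c) \<in># R" by auto
  hence "(Suc i, c) \<in># Q" by (simp add: Q_def)
  hence "Q \<noteq> {#}" by auto
  ultimately show "R \<in> ?R" using \<open>R = P + Q\<close> by (auto simp: gapless_upto_def)
next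
  fix R assume "R \<in> ?R"
  then obtain P Q where "R = P + Q" "P \<in> gapless_upto k i"
    and Q: "set_mset Q \<subseteq> {Suc i} \<times> {1..k (Suc i)}" "Q \<noteq> {#}" by auto
  moreover have "fst ` set_mset Q \<subseteq> {Suc i}" using Q by auto
  hence "fst ` set_mset Q = {Suc i}"
    using Q(2) by (metis image_is_empty set_mset_eq_empty_iff subset_singletonD)
  ultimately show "R \<in> gapless_upto k (Suc i)"
    by (auto simp: gapless_upto_def image_Un atLeast0_atMost_Suc)
qed

lemma mset_gf_gapless_upto:
  assumes "m \<ge> 1"
  shows "mset_gf (\<lambda>(j, c). m ^ j) (gapless_upto k i) =
    (\<Prod>j=0..i. (inv_one_minus_X_power (m ^ j) ^ k j - 1))"
proof -
  let ?w = "\<lambda>(j, c). m ^ j"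
  have block: "mset_gf ?w {P. set_mset P \<subseteq> {j} \<times> {1..k j} \<and> P \<noteq> {#}} =
      inv_one_minus_X_power (m ^ j) ^ k j - 1" for j
  proof -
    \<comment> \<open>All \<open>k j\<close> colours of a part have the same weight, so the product
      becomes a power.\<close>
    have "(\<Prod>a\<in>{j} \<times> {1..k j}. inv_one_minus_X_power (?w a)) =
        (\<Prod>a\<in>{j} \<times> {1..k j}. inv_one_minus_X_power (m ^ j))"
      by (rule prod.cong) auto
    thus ?thesis
      by (subst mset_gf_supported_nonempty) (use assms in auto)
  qed
  show ?thesis
  proof (induction i)
    case 0
    show ?case using block[of 0] by (simp add: gapless_upto_0)
  next
    case (Suc i)
    have "mset_gf ?w (gapless_upto k (Suc i)) = mset_gf ?w (gapless_upto k i) *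
        mset_gf ?w {P. set_mset P \<subseteq> {Suc i} \<times> {1..k (Suc i)} \<and> P \<noteq> {#}}"
      unfolding gapless_upto_Suc
      by (rule mset_gf_plus[where A = "SIGMA j:{0..i}. {1..k j}" and B = "{Suc i} \<times> {1..k (Suc i)}"])
        (use assms in \<open>auto simp: gapless_upto_def\<close>)
    thus ?case using Suc block by simp
  qed
qed

text \<open>A nonempty finite set of exponents closed under predecessor is an initial segment ending
  at its maximum.\<close>

lemma without_gaps_iff:
  assumes "P \<noteq> {#}"
  shows "without_gaps P \<longleftrightarrow> (\<exists>i. fst ` set_mset P = {0..i})"
proof
  assume gap: "without_gaps P"
  let ?i = "Max (fst ` set_mset P)"
  have down: "j \<in> fst ` set_mset P" if "Suc j \<in> fst ` set_mset P" for j
  proof -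
    from that obtain c where "(Suc j, c) \<in># P" by auto
    with gap obtain c' where "(j, c') \<in># P" by (auto simp: without_gaps_def)
    thus ?thesis by force
  qed
  have "?i \<in> fst ` set_mset P"
    using assms by (intro Max_in) auto
  have "j \<in> fst ` set_mset P" if "j \<le> ?i" for j
    using that \<open>?i \<in> fst ` set_mset P\<close> by (induction j rule: inc_induct) (blast intro: down)+
  moreover have "j \<le> ?i" if "j \<in> fst ` set_mset P" for j
    using that by (intro Max_ge) auto
  ultimately have "fst ` set_mset P = {0..?i}"
    by (meson atLeastAtMost_iff le0 subsetI subset_antisym)
  thus "\<exists>i. fst ` set_mset P = {0..i}" by blast
next
  assume "\<exists>i. fst ` set_mset P = {0..i}"
  then obtain i where i: "fst ` set_mset P = {0..i}" by blast
  have "\<exists>c. (j, c) \<in># P" if "(Suc j, c) \<in># P" for j c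
  proof -
    have "Suc j \<in> fst ` set_mset P" using that by force
    hence "j \<in> fst ` set_mset P" unfolding i by simp
    thus ?thesis by auto
  qed
  thus "without_gaps P" by (auto simp: without_gaps_def)
qed

text \<open>The largest exponent satisfies \<open>i < m ^ i\<close> and
  \<open>m ^ i \<le> n\<close>, so \<open>n\<close> bounds the index of the union.\<close>

lemma gapless_partitions_eq_UN:
  assumes "m \<ge> 2" "n \<noteq> 0"
  shows "{P \<in> coloured_mary_partitions m k n. without_gaps P} =
    (\<Union>i\<in>{..n}. {P \<in> gapless_upto k i. (\<Sum>(j, c)\<in>#P. m ^ j) = n})"
proof (intro equalityI subsetI)
  fix P assume P: "P \<in> {P \<in> coloured_mary_partitions m k n. without_gaps P}"
  hence "P \<noteq> {#}" using assms by (auto simp: coloured_mary_partitions_def)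
  then obtain i where i: "fst ` set_mset P = {0..i}" using P without_gaps_iff by blast
  hence "i \<in> fst ` set_mset P" by simp
  then obtain c where "(i, c) \<in># P" by auto
  then obtain Q where "P = add_mset (i, c) Q" by (meson mset_add)
  hence "m ^ i \<le> n" using P by (auto simp: coloured_mary_partitions_def)
  moreover have "i < m ^ i" using assms by (intro power_gt_expt) simp
  moreover have "set_mset P \<subseteq> (SIGMA j:{0..i}. {1..k j})"
  proof
    fix x assume x: "x \<in># P"
    hence "fst x \<in> {0..i}" unfolding i[symmetric] by simp
    thus "x \<in> (SIGMA j:{0..i}. {1..k j})" using P x by (force simp: coloured_mary_partitions_def)
  qed
  ultimately show "P \<in> (\<Union>i\<in>{..n}. {P \<in> gapless_upto k i. (\<Sum>(j, c)\<in>#P. m ^ j) = n})"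
    using P i by (auto simp: gapless_upto_def coloured_mary_partitions_def intro!: bexI[of _ i])
next
  fix P assume "P \<in> (\<Union>i\<in>{..n}. {P \<in> gapless_upto k i. (\<Sum>(j, c)\<in>#P. m ^ j) = n})"
  then obtain i where "P \<in> gapless_upto k i" "(\<Sum>(j, c)\<in>#P. m ^ j) = n" by auto
  moreover from this have "P \<noteq> {#}" using assms by auto
  ultimately show "P \<in> {P \<in> coloured_mary_partitions m k n. without_gaps P}"
    by (auto simp: gapless_upto_def coloured_mary_partitions_def without_gaps_iff)
qed

lemma num_gapless_eq_sum:
  assumes "m \<ge> 2" "n \<noteq> 0"
  shows "int (num_gapless m k n) =
    (\<Sum>i\<le>n. (\<Prod>j=0..i. (inv_one_minus_X_power (m ^ j) ^ k j - 1)) $ n)"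
proof -
  let ?G = "\<lambda>i. {P \<in> gapless_upto k i. (\<Sum>(j, c)\<in>#P. m ^ j) = n}"
  have "finite (\<Union>i\<in>{..n}. ?G i)"
    unfolding gapless_partitions_eq_UN[OF assms, symmetric]
    using finite_coloured_mary_partitions[OF assms(1)] by simp
  hence fin: "finite (?G i)" if "i \<le> n" for i
    by (rule rev_finite_subset) (use that in blast)
  \<comment> \<open>The exponent set \<open>{0..i}\<close> determines \<open>i\<close>.\<close>
  have disj: "?G i \<inter> ?G i' = {}" if "i \<noteq> i'" for i i'
    using that by (auto simp: gapless_upto_def)
  have "num_gapless m k n = (\<Sum>i\<le>n. card (?G i))"
    unfolding num_gapless_def gapless_partitions_eq_UN[OF assms]
    by (rule card_UN_disjoint) (use fin disj in auto)
  also have "int \<dots> = (\<Sum>i\<le>n. mset_gf (\<lambda>(j, c). m ^ j) (gapless_upto k i) $ n)"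
    by (simp add: mset_gf_def)
  finally show ?thesis using assms by (simp add: mset_gf_gapless_upto)
qed

section \<open>Coefficients of infinite sums and the generating function\<close>

text \<open>Terms with \<open>i > n\<close> have no coefficient at \<open>n\<close>, so the partial
  sums stabilise coefficientwise.\<close>

lemma fps_suminf_nth:
  fixes f :: "nat \<Rightarrow> int fps"
  assumes "\<And>i. fps_X ^ i dvd f i"
  shows "(\<Sum>i. f i) $ n = (\<Sum>i\<le>n. f i $ n)"
proof -
  have zero: "f i $ n = 0" if "n < i" for i n
    using that assms[of i] by (elim dvdE) (simp add: fps_X_power_mult_nth)
  have "f sums Abs_fps (\<lambda>n. \<Sum>i\<le>n. f i $ n)"
    unfolding sums_def
  proof (rule tendsto_fpsI)
    fix n
    have "(\<Sum>i<N. f i $ n) = (\<Sum>i\<le>n. f i $ n)" if "N \<ge> Suc n" for N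
      by (rule sum.mono_neutral_right) (use that in \<open>auto intro: zero\<close>)
    thus "\<forall>\<^sub>F N in sequentially. (\<Sum>i<N. f i) $ n = Abs_fps (\<lambda>n. \<Sum>i\<le>n. f i $ n) $ n"
      by (intro eventually_sequentiallyI[of "Suc n"]) (simp add: fps_sum_nth)
  qed
  from sums_unique[OF this] show ?thesis by (metis fps_nth_Abs_fps)
qed

lemma fps_X_power_dvd_prod:
  fixes f :: "nat \<Rightarrow> int fps"
  assumes "finite A" "\<And>j. j \<in> A \<Longrightarrow> f j $ 0 = 0" "i \<le> card A"
  shows "fps_X ^ i dvd (\<Prod>j\<in>A. f j)"
proof -
  have "(\<Prod>j\<in>A. fps_X) dvd (\<Prod>j\<in>A. f j)"
    by (rule prod_dvd_prod) (use assms fps_X_dvd in auto)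
  thus ?thesis using assms(3) by (metis dvd_trans le_imp_power_dvd prod_constant)
qed

lemma fps_X_power_dvd_gapless_term:
  "fps_X ^ i dvd (\<Prod>j=0..i. (inv_one_minus_X_power (m ^ j) ^ k j - 1))"
  by (rule fps_X_power_dvd_prod) (auto simp: inv_one_minus_X_power_def fps_power_zeroth)

lemma gapless_gf_eq_suminf:
  assumes "m \<ge> 2"
  shows "gapless_gf m k = 1 + (\<Sum>i. \<Prod>j=0..i. (inv_one_minus_X_power (m ^ j) ^ k j - 1))"
proof (rule fps_ext)
  fix n
  \<comment> \<open>Needed at \<open>n = 0\<close>, where only the term \<open>i = 0\<close> remains
    and must contribute 0.\<close>
  have "(inv_one_minus_X_power N ^ r - 1) $ 0 = 0" for N r
    by (simp add: inv_one_minus_X_power_def fps_power_zeroth)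
  thus "gapless_gf m k $ n = (1 + (\<Sum>i. \<Prod>j=0..i. (inv_one_minus_X_power (m ^ j) ^ k j - 1))) $ n"
    using assms
    by (cases "n = 0")
      (simp_all add: gapless_gf_def fps_suminf_nth[OF fps_X_power_dvd_gapless_term] num_gapless_eq_sum)
qed

section \<open>Congruences\<close>

lemma fps_cong_refl: "fps_cong f f m"
  by (simp add: fps_cong_def)

lemma fps_cong_trans: "fps_cong f g m \<Longrightarrow> fps_cong g h m \<Longrightarrow> fps_cong f h m"
  unfolding fps_cong_def by (blast intro: cong_trans)

lemma fps_cong_mult: "fps_cong f f' m \<Longrightarrow> fps_cong g g' m \<Longrightarrow> fps_cong (f * g) (f' * g') m"
  unfolding fps_cong_def by (auto simp: fps_mult_nth intro!: cong_sum cong_mult)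

lemma fps_cong_dilated:
  "(\<And>t. [a t = b t] (mod m)) \<Longrightarrow> fps_cong (dilated_fps N a) (dilated_fps N b) m"
  by (simp add: fps_cong_def dilated_fps_def)

lemma sum_monomials_conv_dilated_fps:
  assumes "N \<ge> 1" "m \<ge> 1"
  shows "(\<Sum>l=0..m - 1. fps_const (a l) * fps_X ^ (l * N)) =
    dilated_fps N (\<lambda>t. if t < m then a t else 0)"
proof (rule fps_ext)
  fix n
  have "(\<Sum>l=0..m - 1. fps_const (a l) * fps_X ^ (l * N)) $ n =
      (\<Sum>l\<in>{0..m - 1}. if n = l * N then a l else 0)"
    unfolding fps_sum_nth by (rule sum.cong) (auto simp: fps_X_power_nth)
  also have "\<dots> = (\<Sum>l\<in>{0..m - 1}. if N dvd n \<and> n div N = l then a l else 0)"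
    using assms by (intro sum.cong) auto
  also have "\<dots> = dilated_fps N (\<lambda>t. if t < m then a t else 0) $ n"
    using assms by (cases "N dvd n") (auto simp: dilated_fps_def)
  finally show "(\<Sum>l=0..m - 1. fps_const (a l) * fps_X ^ (l * N)) $ n =
    dilated_fps N (\<lambda>t. if t < m then a t else 0) $ n" .
qed

text \<open>Multiplying by 1 - q^(m N) subtracts the shift by \<open>m\<close>. By periodicity all
  coefficients from index \<open>m\<close> on then vanish modulo \<open>m\<close>, and the first
  \<open>m\<close> survive unchanged.\<close>

lemma fps_cong_periodic:
  assumes "N \<ge> 1" "m \<ge> 1" and per: "\<And>t. [a (t + m) = a t] (mod int m)"
  shows "fps_cong (dilated_fps N a)
    ((\<Sum>l=0..m - 1. fps_const (a l) * fps_X ^ (l * N)) * inv_one_minus_X_power (m * N)) (int m)"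
proof -
  have pos: "m * N \<ge> 1" using assms by simp
  let ?b = "\<lambda>t. a t - (if m \<le> t then a (t - m) else 0)"
  \<comment> \<open>This identity is exact over the integers; only \<open>?b\<close> is then reduced
    modulo \<open>m\<close>.\<close>
  have eq: "dilated_fps N a = dilated_fps N ?b * inv_one_minus_X_power (m * N)"
    by (rule inv_one_minus_X_power_eqI[OF pos dilated_fps_mult_one_minus]) fact
  have "[?b t = (if t < m then a t else 0)] (mod int m)" for t
    using per[of "t - m"] by (auto simp: cong_diff_iff_cong_0)
  hence "fps_cong (dilated_fps N ?b) (dilated_fps N (\<lambda>t. if t < m then a t else 0)) (int m)"
    by (rule fps_cong_dilated)
  hence "fps_cong (dilated_fps N ?b) (\<Sum>l=0..m - 1. fps_const (a l) * fps_X ^ (l * N)) (int m)"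
    by (simp only: sum_monomials_conv_dilated_fps[OF assms(1,2)])
  thus ?thesis
    by (subst eq) (intro fps_cong_mult fps_cong_refl)
qed

section \<open>Binomial series and the congruences for single factors\<close>

text \<open>By Pascal's rule the first differences of the coefficients for \<open>Suc k\<close> are
  those for \<open>k\<close>, so each division by 1 - q^N raises \<open>k\<close> by one.\<close>

lemma inv_one_minus_X_power_power:
  assumes "N \<ge> 1"
  shows "inv_one_minus_X_power N ^ Suc k = dilated_fps N (\<lambda>t. int ((k + t) choose k))"
proof (induction k)
  case 0
  show ?case using assms by (simp add: inv_one_minus_X_power_conv_dilated_fps)
next
  case (Suc k)
  \<comment> \<open>At \<open>t = 0\<close> nothing is subtracted and both sides equal 1.\<close>
  have "int ((Suc k + t) choose Suc k) - (if 1 \<le> t then int ((Suc k + (t - 1)) choose Suc k) else 0) =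
      int ((k + t) choose k)" for t
    by (cases t) auto
  hence "dilated_fps N (\<lambda>t. int ((Suc k + t) choose Suc k)) * (1 - fps_X ^ N) =
      dilated_fps N (\<lambda>t. int ((k + t) choose k))"
    using dilated_fps_mult_one_minus[OF assms, of "\<lambda>t. int ((Suc k + t) choose Suc k)" 1]
    by simp
  from inv_one_minus_X_power_eqI[OF assms this] Suc show ?case by simp
qed

text \<open>Multiplied by \<open>fact k\<close>, the binomial coefficient becomes (t+1)...(t+k), an
  integer polynomial in \<open>t\<close> and hence periodic modulo \<open>m\<close>; the unit
  \<open>fact k\<close> then cancels.\<close>

lemma binomial_periodic_cong:
  assumes "coprime m (fact k :: nat)"
  shows "[int ((k + (t + m)) choose k) = int ((k + t) choose k)] (mod int m)"
proof -
  have prod: "fact k * ((k + t) choose k) = (\<Prod>i<k. t + Suc i)" for t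
  proof (induction k)
    case (Suc k)
    have "fact (Suc k) * ((Suc k + t) choose Suc k) = fact k * (Suc k * (Suc (k + t) choose Suc k))"
      by (simp only: fact_Suc of_nat_id add_Suc mult_ac)
    also have "\<dots> = fact k * ((k + t) choose k) * (t + Suc k)"
      unfolding Suc_times_binomial by (simp add: ac_simps)
    finally show ?case using Suc by simp
  qed simp
  have "[(\<Prod>i<k. t + m + Suc i) = (\<Prod>i<k. t + Suc i)] (mod m)"
    by (rule cong_prod) (metis cong_def add.assoc add.commute mod_add_self2)
  hence "[fact k * ((k + (t + m)) choose k) = fact k * ((k + t) choose k)] (mod m)"
    unfolding prod .
  hence "[(k + (t + m)) choose k = (k + t) choose k] (mod m)"
    using assms by (simp add: cong_mult_lcancel_nat coprime_commute)
  thus ?thesis by (simp add: cong_int_iff)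
qed

lemma first_factor_cong:
  assumes "m \<ge> 1" "k \<ge> 1" "coprime m (fact (k - 1) :: nat)"
  shows "fps_cong (inv_one_minus_X_power 1 ^ k - 1)
    ((\<Sum>l=1..m. fps_const (int ((k - 1 + l) choose (k - 1))) * fps_X ^ l) * inv_one_minus_X_power m)
    (int m)"
proof -
  obtain r where k: "k = Suc r" using assms by (cases k) auto
  let ?a = "\<lambda>t. int ((r + (t + 1)) choose r)"
  \<comment> \<open>Without its constant term 1 the series is divisible by q. The shift by one moves
    the window of indices from \<open>{0..m - 1}\<close> to \<open>{1..m}\<close>.\<close>
  have "inv_one_minus_X_power 1 ^ k - 1 = fps_X * dilated_fps 1 ?a"
    unfolding k inv_one_minus_X_power_power[OF order.refl]
    by (auto simp: fps_eq_iff dilated_fps_def fps_X_mult_nth)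
  moreover have "[?a (t + m) = ?a t] (mod int m)" for t
    using binomial_periodic_cong[OF assms(3), of "t + 1"] by (simp add: k ac_simps del: binomial_Suc_Suc)
  hence "fps_cong (dilated_fps 1 ?a)
      ((\<Sum>l=0..m - 1. fps_const (?a l) * fps_X ^ (l * 1)) * inv_one_minus_X_power (m * 1)) (int m)"
    by (rule fps_cong_periodic[OF order.refl assms(1)])
  hence "fps_cong (fps_X * dilated_fps 1 ?a) (fps_X *
      ((\<Sum>l=0..m - 1. fps_const (?a l) * fps_X ^ (l * 1)) * inv_one_minus_X_power (m * 1))) (int m)"
    by (intro fps_cong_mult fps_cong_refl)
  moreover have "(\<Sum>l=1..m. fps_const (int ((k - 1 + l) choose (k - 1))) * fps_X ^ l) =
      fps_X * (\<Sum>l=0..m - 1. fps_const (?a l) * fps_X ^ (l * 1))"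
  proof -
    obtain s where "m = Suc s" using assms by (cases m) auto
    thus ?thesis
      by (simp only: k One_nat_def sum.shift_bounds_cl_Suc_ivl sum_distrib_left) (simp add: ac_simps)
  qed
  ultimately show ?thesis by (simp add: mult.assoc)
qed

text \<open>The extra geometric factor raises the exponent to \<open>k + 1\<close>, which produces
  \<open>(k + l) choose k\<close> and calls for \<open>fact k\<close> to be a unit; its product with
  the -1 lowers each coefficient by 1.\<close>

lemma later_factor_cong:
  assumes "m \<ge> 1" "coprime m (fact k :: nat)"
  shows "fps_cong (inv_one_minus_X_power (m ^ j) * (inv_one_minus_X_power (m ^ j) ^ k - 1))
    ((\<Sum>l=0..m - 1. fps_const (int ((k + l) choose k) - 1) * fps_X ^ (l * m ^ j)) *
      inv_one_minus_X_power (m ^ Suc j)) (int m)"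
proof -
  have pos: "m ^ j \<ge> 1" using assms by simp
  have "inv_one_minus_X_power (m ^ j) * (inv_one_minus_X_power (m ^ j) ^ k - 1) =
      inv_one_minus_X_power (m ^ j) ^ Suc k - inv_one_minus_X_power (m ^ j)"
    by (simp add: algebra_simps)
  also have "\<dots> = dilated_fps (m ^ j) (\<lambda>t. int ((k + t) choose k)) - dilated_fps (m ^ j) (\<lambda>_. 1)"
    by (subst inv_one_minus_X_power_power[OF pos])
      (simp only: inv_one_minus_X_power_conv_dilated_fps[OF pos])
  also have "\<dots> = dilated_fps (m ^ j) (\<lambda>t. int ((k + t) choose k) - 1)"
    by (simp add: dilated_fps_def fps_eq_iff)
  finally show ?thesis
    using fps_cong_periodic[OF pos assms(1), of "\<lambda>t. int ((k + t) choose k) - 1"]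
      binomial_periodic_cong[OF assms(2)]
    by (simp add: cong_diff)
qed

text \<open>Induction on the largest exponent: each term carries one spare geometric factor, which
  the next factor consumes and returns at the next power of \<open>m\<close>.\<close>

lemma gapless_term_cong:
  fixes m :: nat and k :: "nat \<Rightarrow> nat"
  assumes "m \<ge> 1" "k 0 \<ge> 1" "coprime m (fact (k 0 - 1))"
    and "\<And>j. j \<ge> 1 \<Longrightarrow> coprime m (fact (k j))"
  shows "fps_cong (\<Prod>j=0..i. (inv_one_minus_X_power (m ^ j) ^ k j - 1))
    ((\<Sum>l=1..m. fps_const (int ((k 0 - 1 + l) choose (k 0 - 1))) * fps_X ^ l) *
      (inv_one_minus_X_power (m ^ (i + 1)) *
        (\<Prod>j=1..i. \<Sum>l=0..m - 1.
          fps_const (int ((k j + l) choose k j) - 1) * fps_X ^ (l * m ^ j)))) (int m)"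
proof (induction i)
  case 0
  show ?case using first_factor_cong[OF assms(1-3)] by simp
next
  case (Suc i)
  define F where "F j = inv_one_minus_X_power (m ^ j) ^ k j - 1" for j
  define A :: "int fps" where
    "A = (\<Sum>l=1..m. fps_const (int ((k 0 - 1 + l) choose (k 0 - 1))) * fps_X ^ l)"
  define B :: "nat \<Rightarrow> int fps" where
    "B j = (\<Sum>l=0..m - 1. fps_const (int ((k j + l) choose k j) - 1) * fps_X ^ (l * m ^ j))" for j
  define I where "I j = inv_one_minus_X_power (m ^ j)" for j
  have "fps_cong ((\<Prod>j=0..i. F j) * F (Suc i)) (A * (I (i + 1) * (\<Prod>j=1..i. B j)) * F (Suc i)) (int m)"
    using Suc.IH by (intro fps_cong_mult fps_cong_refl) (simp only: A_def B_def F_def I_def)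
  hence "fps_cong (\<Prod>j=0..Suc i. F j) (A * (\<Prod>j=1..i. B j) * (I (Suc i) * F (Suc i))) (int m)"
    by (simp add: ac_simps)
  \<comment> \<open>The spare factor \<open>I (Suc i)\<close> is exactly the one that
    \<open>F (Suc i)\<close> has to be paired with.\<close>
  moreover have "fps_cong (I (Suc i) * F (Suc i)) (B (Suc i) * I (Suc (Suc i))) (int m)"
    unfolding B_def F_def I_def by (rule later_factor_cong) (use assms in auto)
  ultimately have "fps_cong (\<Prod>j=0..Suc i. F j)
      (A * (\<Prod>j=1..i. B j) * (B (Suc i) * I (Suc (Suc i)))) (int m)"
    by (blast intro: fps_cong_trans fps_cong_mult fps_cong_refl)
  hence "fps_cong (\<Prod>j=0..Suc i. F j) (A * (I (Suc i + 1) * (\<Prod>j=1..Suc i. B j))) (int m)"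
    by (simp add: ac_simps)
  thus ?case by (simp only: A_def B_def F_def I_def)
qed

section \<open>Summing the termwise congruences\<close>

text \<open>Each of the \<open>i\<close> polynomial factors has constant term 0: its coefficient at
  \<open>l = 0\<close> is \<open>(k j choose k j) - 1\<close>.\<close>

lemma fps_X_power_dvd_congruence_term:
  assumes "m \<ge> 1"
  shows "fps_X ^ i dvd inv_one_minus_X_power (m ^ (i + 1)) *
    (\<Prod>j=1..i. \<Sum>l=0..m - 1. fps_const (int ((k j + l) choose k j) - 1) * fps_X ^ (l * m ^ j))"
  by (rule dvd_mult, rule fps_X_power_dvd_prod)
    (use assms in \<open>auto simp: fps_sum_nth intro!: sum.neutral\<close>)

text \<open>Every coefficient of either sum is a finite sum over the same range, so termwise
  congruence suffices.\<close>

lemma fps_cong_suminf: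
  fixes f g :: "nat \<Rightarrow> int fps"
  assumes "\<And>i. fps_cong (f i) (g i) m" "\<And>i. fps_X ^ i dvd f i" "\<And>i. fps_X ^ i dvd g i"
  shows "fps_cong (\<Sum>i. f i) (\<Sum>i. g i) m"
  using assms(1) unfolding fps_cong_def fps_suminf_nth[OF assms(2)] fps_suminf_nth[OF assms(3)]
  by (auto intro: cong_sum)

lemma fps_suminf_mult_left:
  fixes f :: "nat \<Rightarrow> int fps"
  assumes "\<And>i. fps_X ^ i dvd f i"
  shows "(\<Sum>i. c * f i) = c * (\<Sum>i. f i)"
proof (rule fps_ext)
  fix n
  have zero: "f i $ n = 0" if "n < i" for i n
    using that assms[of i] by (elim dvdE) (simp add: fps_X_power_mult_nth)
  have "(\<Sum>i. c * f i) $ n = (\<Sum>i\<le>n. \<Sum>s=0..n. c $ s * f i $ (n - s))"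
    using assms by (subst fps_suminf_nth) (auto simp: fps_mult_nth)
  also have "\<dots> = (\<Sum>s=0..n. c $ s * (\<Sum>i\<le>n. f i $ (n - s)))"
    by (subst sum.swap) (simp add: sum_distrib_left)
  \<comment> \<open>The coefficient of \<open>f i\<close> at \<open>n - s\<close> vanishes for
    \<open>i > n - s\<close>; the shorter range is the one that gives this coefficient of the
    infinite sum.\<close>
  also have "\<dots> = (\<Sum>s=0..n. c $ s * (\<Sum>i\<le>n - s. f i $ (n - s)))"
    by (intro sum.cong arg_cong2[of _ _ _ _ "(*)"] sum.mono_neutral_right refl) (auto intro: zero)
  also have "\<dots> = (c * (\<Sum>i. f i)) $ n"
    by (simp add: fps_mult_nth fps_suminf_nth[OF assms])
  finally show "(\<Sum>i. c * f i) $ n = (c * (\<Sum>i. f i)) $ n" .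
qed

theorem theorem3p1:
  fixes m :: nat and k :: "nat \<Rightarrow> nat"
  assumes "m \<ge> 2"
    and "\<And>j. k j \<ge> 1"
    and "coprime m (fact (k 0 - 1))"
    and "\<And>j. j \<ge> 1 \<Longrightarrow> coprime m (fact (k j))"
  shows "gapless_gf m k = 1 + (\<Sum>i. \<Prod>j=0..i. (inv_one_minus_X_power (m ^ j) ^ k j - 1)) \<and>
    fps_cong (gapless_gf m k)
      (1 + (\<Sum>l=1..m. fps_const (int ((k 0 - 1 + l) choose (k 0 - 1))) * fps_X ^ l) *
           (\<Sum>i. inv_one_minus_X_power (m ^ (i + 1)) *
              (\<Prod>j=1..i. \<Sum>l=0..m - 1.
                 fps_const (int ((k j + l) choose k j) - 1) * fps_X ^ (l * m ^ j))))
      (int m)"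
proof -
  let ?F = "\<lambda>i. \<Prod>j=0..i. (inv_one_minus_X_power (m ^ j) ^ k j - 1)"
  let ?A = "\<Sum>l=1..m. fps_const (int ((k 0 - 1 + l) choose (k 0 - 1))) * fps_X ^ l :: int fps"
  let ?G = "\<lambda>i. inv_one_minus_X_power (m ^ (i + 1)) *
    (\<Prod>j=1..i. \<Sum>l=0..m - 1. fps_const (int ((k j + l) choose k j) - 1) * fps_X ^ (l * m ^ j))"
  have m: "m \<ge> 1" using assms(1) by simp
  note dvd = fps_X_power_dvd_congruence_term[OF m, of _ k]
  have "fps_cong (\<Sum>i. ?F i) (\<Sum>i. ?A * ?G i) (int m)"
  proof (rule fps_cong_suminf)
    show "fps_cong (?F i) (?A * ?G i) (int m)" for i
      using m assms(2-4) by (rule gapless_term_cong)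
    show "fps_X ^ i dvd ?F i" for i
      by (rule fps_X_power_dvd_gapless_term)
    show "fps_X ^ i dvd ?A * ?G i" for i
      by (rule dvd_mult) (rule dvd)
  qed
  \<comment> \<open>The contribution of the smallest part is common to all terms and factors
    out.\<close>
  moreover have "(\<Sum>i. ?A * ?G i) = ?A * (\<Sum>i. ?G i)"
    by (rule fps_suminf_mult_left) (rule dvd)
  ultimately have "fps_cong (1 + (\<Sum>i. ?F i)) (1 + ?A * (\<Sum>i. ?G i)) (int m)"
    by (simp add: fps_cong_def cong_add_lcancel)
  thus ?thesis using gapless_gf_eq_suminf[OF assms(1)] by simp
qed

end
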